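(* Let $h>k$ be relatively prime squarefree positive integers, $m=hk^2$, $\alpha$ the real cube root of $m$, $K=\mathbb{Q}(\alpha)$. Let $I$ be a primitive ideal of $\mathcal{O}_K$ of length $L$. If $L>\frac{6\sqrt3\,m}{\pi}$, then $I$ is not reduced.
   Context: Let $\widehat\alpha$ be the real cube root of $h^2k$, $\sigma=3$ if $m\equiv\pm1\pmod 9$ and $1$ otherwise, $\theta=\frac1\sigma(k\pm k\alpha+\widehat\alpha)$ (sign $-$ if $m\equiv-1\pmod9$, $+$ otherwise); then $\mathcal{O}_K=\mathbb{Z}\oplus\alpha\mathbb{Z}\oplus\theta\mathbb{Z}$. Every nonzero ideal has a unique canonical form $a\mathbb{Z}+(b+c\alpha)\mathbb{Z}+(d+e\alpha+f\theta)\mathbb{Z}$ with integers $a,c,f>0$, $0\le b<a$, $0\le d<a$, $0\le e<c$; its length $L=a$ is the smallest positive rational integer in it, and it is primitive if $\gcd(a,b,c,d,e,f)=1$. The shadow $\mathrm{Sh}(\beta)$ of $\beta\in K$ is the product of the two conjugates of $\beta$ other than $\beta$ itself; $|\beta|$ is the absolute value of the real number $\beta$. A primitive ideal $I$ of length $L$ is reduced if for all $\beta\in I$, $|\beta|<L$ and $|\mathrm{Sh}(\beta)|<L^2$ together imply $\beta=0$. *)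

theory Defs
  imports
    "HOL-Analysis.Analysis"
    "HOL-Algebra.Ideal"
    "HOL-Algebra.Generated_Fields"
    "HOL-Computational_Algebra.Squarefree"
    "HOL-Number_Theory.Cong"
begin

text \<open>A subset of a type-class ring, with the ambient operations, as a record for HOL-Algebra.\<close>

definition ring_on :: "'a::comm_ring_1 set \<Rightarrow> 'a ring" where
  "ring_on A = \<lparr>carrier = A, mult = (*), one = 1, zero = 0, add = (+)\<rparr>"

definition radicand :: "nat \<Rightarrow> nat \<Rightarrow> nat" where
  "radicand h k = h * k\<^sup>2"

definition cbrt_m :: "nat \<Rightarrow> nat \<Rightarrow> real" where
  "cbrt_m h k = root 3 (real (radicand h k))"

definition cbrt_m' :: "nat \<Rightarrow> nat \<Rightarrow> real" where
  "cbrt_m' h k = root 3 (real (h\<^sup>2 * k))"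

definition cubic_field :: "nat \<Rightarrow> nat \<Rightarrow> real set" where
  "cubic_field h k = generate_field (ring_on UNIV) {cbrt_m h k}"

definition cubic_integers :: "nat \<Rightarrow> nat \<Rightarrow> real set" where
  "cubic_integers h k = {x \<in> cubic_field h k. algebraic_int x}"

definition sigma :: "nat \<Rightarrow> nat \<Rightarrow> int" where
  "sigma h k =
    (if [int (radicand h k) = 1] (mod 9) \<or> [int (radicand h k) = - 1] (mod 9) then 3 else 1)"

definition theta :: "nat \<Rightarrow> nat \<Rightarrow> real" where
  "theta h k =
    (if [int (radicand h k) = - 1] (mod 9)
     then (real k - real k * cbrt_m h k + cbrt_m' h k) / of_int (sigma h k)
     else (real k + real k * cbrt_m h k + cbrt_m' h k) / of_int (sigma h k))"

definition canonical_form ::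
    "nat \<Rightarrow> nat \<Rightarrow> real set \<Rightarrow> int \<Rightarrow> int \<Rightarrow> int \<Rightarrow> int \<Rightarrow> int \<Rightarrow> int \<Rightarrow> bool" where
  "canonical_form h k I a b c d e f \<longleftrightarrow>
     a > 0 \<and> c > 0 \<and> f > 0 \<and> 0 \<le> b \<and> b < a \<and> 0 \<le> d \<and> d < a \<and> 0 \<le> e \<and> e < c \<and>
     I = {of_int x * of_int a
          + of_int y * (of_int b + of_int c * cbrt_m h k)
          + of_int z * (of_int d + of_int e * cbrt_m h k + of_int f * theta h k)
          | x y z :: int. True}"

definition ideal_length :: "real set \<Rightarrow> nat" where
  "ideal_length I = (LEAST n. n > 0 \<and> real n \<in> I)"

definition primitive_ideal :: "nat \<Rightarrow> nat \<Rightarrow> real set \<Rightarrow> bool" where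
  "primitive_ideal h k I \<longleftrightarrow>
     ideal I (ring_on (cubic_integers h k)) \<and>
     (\<exists>a b c d e f. canonical_form h k I a b c d e f \<and> Gcd {a, b, c, d, e, f} = 1)"

text \<open>
  The complex embeddings of a field \<open>K\<close> of real numbers. They are extensional (constantly
  \<open>undefined\<close> outside \<open>K\<close>), so that two embeddings are equal iff they agree on \<open>K\<close>.
\<close>

definition embeddings :: "real set \<Rightarrow> (real \<Rightarrow> complex) set" where
  "embeddings K = ring_hom (ring_on K) (ring_on UNIV) \<inter> extensional K"

text \<open>
  The product runs over the embeddings other than the inclusion of \<open>K\<close>, so conjugates are
  counted with multiplicity: for \<open>K\<close> cubic and \<open>\<beta>\<close> rational, the shadow of \<open>\<beta>\<close> is \<open>\<beta>\<^sup>2\<close>.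
\<close>

definition shadow :: "real set \<Rightarrow> real \<Rightarrow> complex" where
  "shadow K \<beta> = (\<Prod>\<tau> \<in> embeddings K - {restrict complex_of_real K}. \<tau> \<beta>)"

definition reduced_ideal :: "nat \<Rightarrow> nat \<Rightarrow> real set \<Rightarrow> bool" where
  "reduced_ideal h k I \<longleftrightarrow>
     primitive_ideal h k I \<and>
     (\<forall>\<beta>\<in>I. \<bar>\<beta>\<bar> < real (ideal_length I) \<and>
            cmod (shadow (cubic_field h k) \<beta>) < (real (ideal_length I))\<^sup>2 \<longrightarrow> \<beta> = 0)"

end

theory Submission
  imports Defs
begin

text \<open>
  Embed \<open>K\<close> into \<open>\<real> \<times> \<complex>\<close>. An ideal in canonical form has covolume
  \<open>(3 * sqrt 3 / 2) * h * k * a * c * f / \<sigma>\<close>, and the conditions \<open>\<bar>\<beta>\<bar> < L\<close>,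
  \<open>\<bar>Sh \<beta>\<bar> < L\<^sup>2\<close> cut out a convex symmetric cylinder of volume \<open>2 * pi * L ^ 3\<close>.
  Since the ideal contains \<open>a * \<alpha>\<close> and \<open>a\<close> times the cube root of \<open>h\<^sup>2 * k\<close>, primitivity
  forces \<open>c * f\<close> to divide \<open>\<sigma> * a\<close>, so for \<open>L\<close> above the stated bound Minkowski's
  theorem yields a nonzero element of the ideal in the cylinder.
\<close>

section \<open>Geometry of numbers: the theorems of Blichfeldt and Minkowski for the integer
  lattice\<close>

text \<open>Cut \<open>S\<close> along the half-open integer unit cells and translate every piece
  into the unit cube. If no two distinct points of \<open>S\<close> differed by an integer vector,
  the translated pieces would stay disjoint, and the measure of \<open>S\<close> would be at most
  1.\<close>

lemma blichfeldt:
  fixes S :: "(real ^ 'n) set"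
  assumes S: "S \<in> lmeasurable" and gt: "measure lebesgue S > 1"
  obtains x y where "x \<in> S" "y \<in> S" "x \<noteq> y" "\<And>i. x $ i - y $ i \<in> \<int>"
proof (rule ccontr)
  note pair = that
  assume nt: "\<not> thesis"
  have sep: "x = y" if "x \<in> S" "y \<in> S" "\<And>i. x $ i - y $ i \<in> \<int>" for x y
    using that nt pair by metis
  define v :: "int ^ 'n \<Rightarrow> real ^ 'n" where "v n = (\<chi> i. of_int (n $ i))" for n
  define A where "A n = S \<inter> {x. \<forall>i. x $ i \<in> {of_int (n $ i)..<of_int (n $ i) + 1}}" for n :: "int ^ 'n"
  define B where "B n = (+) (- v n) ` A n" for n
  have cell: "{x :: real ^ 'n. \<forall>i. x $ i \<in> {of_int (n $ i)..<of_int (n $ i) + 1}} \<in> sets lebesgue" for n :: "int ^ 'n"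
  proof -
    have "{x :: real ^ 'n. \<forall>i. x $ i \<in> {of_int (n $ i)..<of_int (n $ i) + 1}} \<in> sets borel"
      by measurable
    then show ?thesis
      by simp
  qed
  have A: "A n \<in> sets lebesgue" for n
    unfolding A_def using S cell by (auto simp: fmeasurable_def)
  have B: "B n \<in> sets lebesgue" for n
    unfolding B_def using A by (rule lebesgue_sets_translation)
  have AB: "emeasure lebesgue (B n) = emeasure lebesgue (A n)" for n
    unfolding B_def using emeasure_lebesgue_affine[of 1 "- v n" "A n"]
    by (simp cong: image_cong_simp add: add.commute)
  have fl: "n $ i = \<lfloor>x $ i\<rfloor>" if "x \<in> A n" for x n i
    using that unfolding A_def by (force intro!: floor_unique[symmetric])
  have UA: "(\<Union>n. A n) = S"
  proof -
    have "x \<in> A (\<chi> i. \<lfloor>x $ i\<rfloor>)" if "x \<in> S" for x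
      using that unfolding A_def by simp
    then show ?thesis
      by (metis (mono_tags, lifting) A_def IntD1 UNIV_I UN_I equalityI subsetI UN_E)
  qed
  have dA: "disjoint_family A"
    unfolding disjoint_family_on_def by (metis disjoint_iff fl vec_eq_iff)
  have BS: "\<exists>x. x \<in> A n \<and> z = x - v n" if "z \<in> B n" for z n
    using that by (auto simp: B_def)
  \<comment> \<open>A common point of two translates comes from two points of \<open>S\<close> with
    integer difference. By \<open>sep\<close> these coincide, so they lie in the same cell.\<close>
  have dB: "disjoint_family B"
  proof (unfold disjoint_family_on_def, safe)
    fix m n z assume "m \<noteq> n" "z \<in> B m" "z \<in> B n"
    then obtain x y where x: "x \<in> A m" "z = x - v m" and y: "y \<in> A n" "z = y - v n"
      using BS by blast
    have "x $ i - y $ i = of_int (m $ i - n $ i)" for i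
    proof -
      have "(x - v m) $ i = (y - v n) $ i"
        using x y by simp
      then show ?thesis
        by (simp add: v_def)
    qed
    then have "x = y"
      using x y by (intro sep) (auto simp: A_def)
    then have "m = n"
      using fl x y by (metis vec_eq_iff)
    then show "z \<in> {}"
      using \<open>m \<noteq> n\<close> by simp
  qed
  have Bsub: "B n \<subseteq> cbox 0 1" for n
    by (auto simp: B_def A_def v_def mem_box_cart algebra_simps less_imp_le)
  have "emeasure lebesgue S = (\<integral>\<^sup>+n. emeasure lebesgue (A n) \<partial>count_space UNIV)"
    using emeasure_UN_countable[of UNIV A lebesgue] A dA UA by simp
  also have "\<dots> = (\<integral>\<^sup>+n. emeasure lebesgue (B n) \<partial>count_space UNIV)"
    by (simp add: AB)
  also have "\<dots> = emeasure lebesgue (\<Union>n. B n)"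
    using emeasure_UN_countable[of UNIV B lebesgue] B dB by simp
  also have "\<dots> \<le> emeasure lebesgue (cbox 0 (1 :: real ^ 'n))"
    using Bsub by (intro emeasure_mono) auto
  also have "\<dots> = 1"
  proof -
    have "measure lebesgue (cbox 0 (1 :: real ^ 'n)) = 1"
      using content_cbox_cart[of 0 "1 :: real ^ 'n"] by (simp add: interval_eq_empty_cart)
    then show ?thesis
      using emeasure_eq_measure2[OF lmeasurable_cbox, of 0 "1 :: real ^ 'n"] by simp
  qed
  finally have "emeasure lebesgue S \<le> 1" .
  then show False
    using gt S by (simp add: emeasure_eq_measure2)
qed

text \<open>Blichfeldt's theorem applies to \<open>S\<close> shrunk by the factor 1/2. The
  difference of the two points found there is the midpoint of \<open>s\<close> and
  \<open>- t\<close>, which symmetry and convexity keep inside \<open>S\<close>.\<close>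

lemma minkowski_convex_body:
  fixes S :: "(real ^ 'n) set"
  assumes S: "S \<in> lmeasurable" and "convex S" and sym: "\<And>x. x \<in> S \<Longrightarrow> - x \<in> S"
    and gt: "measure lebesgue S > 2 ^ CARD('n)"
  obtains x where "x \<in> S" "x \<noteq> 0" "\<And>i. x $ i \<in> \<int>"
proof -
  define T where "T = (\<lambda>x. (1/2) *\<^sub>R x) ` S"
  \<comment> \<open>Measurability of \<open>T\<close> is obtained by viewing it as a preimage of
    \<open>S\<close> under doubling.\<close>
  have "x \<in> T" if "2 *\<^sub>R x \<in> S" for x
    using that unfolding T_def by (intro image_eqI[of _ _ "2 *\<^sub>R x"]) auto
  then have "T = (*\<^sub>R) 2 -` S"
    unfolding T_def by auto
  then have "T \<in> sets lebesgue"
    using S measurable_sets[OF lebesgue_measurable_scaling[of 2], of S] by auto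
  moreover have "emeasure lebesgue T < \<infinity>"
    unfolding T_def using S emeasure_lebesgue_affine[of "1/2" 0 S]
    by (simp add: fmeasurable_def ennreal_mult_less_top del: emeasure_completion)
  ultimately have T: "T \<in> lmeasurable"
    by (rule fmeasurableI)
  have "measure lebesgue T = (1/2) ^ CARD('n) * measure lebesgue S"
    unfolding T_def using measure_lebesgue_affine[of "1/2" 0 S] by simp
  then have "2 ^ CARD('n) * 1 < 2 ^ CARD('n) * measure lebesgue T"
    using gt by (simp add: field_simps power_one_over)
  then have "measure lebesgue T > 1"
    by (simp only: mult_less_cancel_left_pos zero_less_power zero_less_numeral)
  then obtain x y where "x \<in> T" "y \<in> T" "x \<noteq> y" and int: "\<And>i. x $ i - y $ i \<in> \<int>"
    using blichfeldt[OF T] by blast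
  then obtain s t where s: "s \<in> S" "x = (1/2) *\<^sub>R s" and t: "t \<in> S" "y = (1/2) *\<^sub>R t"
    unfolding T_def by blast
  have "(1/2) *\<^sub>R s + (1/2) *\<^sub>R (- t) \<in> S"
    using s t sym by (intro convexD[OF \<open>convex S\<close>]) auto
  then have "x - y \<in> S"
    using s t by simp
  then show ?thesis
    using that[of "x - y"] \<open>x \<noteq> y\<close> int by simp
qed

section \<open>The cylinder, and Minkowski's theorem for general lattices\<close>

lemma cmod_less_iff: "r > 0 \<Longrightarrow> cmod z < r \<longleftrightarrow> (Re z)\<^sup>2 + (Im z)\<^sup>2 < r\<^sup>2"
  using power_mono_iff[of r "cmod z" 2] by (simp add: cmod_power2[symmetric] not_le[symmetric])

text \<open>Under the identification of real triples with pairs of a real and a complex number, the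
  cylinder is an interval of length \<open>2 * r\<close> times a disc of radius
  \<open>r\<close>.\<close>

lemma measure_cylinder:
  assumes "r > 0"
  shows "{v :: real ^ 3. \<bar>v $ 1\<bar> < r \<and> (v $ 2)\<^sup>2 + (v $ 3)\<^sup>2 < r\<^sup>2} \<in> lmeasurable" (is "?C \<in> _")
    and "measure lebesgue {v :: real ^ 3. \<bar>v $ 1\<bar> < r \<and> (v $ 2)\<^sup>2 + (v $ 3)\<^sup>2 < r\<^sup>2} = 2 * pi * r ^ 3"
proof -
  define f :: "real \<times> complex \<Rightarrow> real ^ 3" where "f p = vector [fst p, Re (snd p), Im (snd p)]" for p
  have f [measurable]: "f \<in> borel_measurable borel"
  proof (rule borel_measurable_continuous_onI)
    have "continuous_on UNIV (\<lambda>p. \<chi> i. f p $ i)"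
    proof (rule continuous_on_vec_lambda)
      fix i :: 3
      show "continuous_on UNIV (\<lambda>p. f p $ i)"
        using exhaust_3[of i] by (elim disjE) (simp_all add: f_def continuous_intros)
    qed
    then show "continuous_on UNIV f"
      by simp
  qed
  \<comment> \<open>Lebesgue measure is determined by its values on boxes, and \<open>f\<close>
    pulls a box back to an interval times a complex box.\<close>
  have "lborel = distr lborel borel f"
  proof (rule lborel_eqI)
    fix l u :: "real ^ 3" assume le: "\<And>b. b \<in> Basis \<Longrightarrow> l \<bullet> b \<le> u \<bullet> b"
    have le: "l $ i \<le> u $ i" for i
      using le[of "axis i 1"] by (simp add: inner_axis axis_in_Basis_iff)
    have "f -` box l u = {l $ 1<..<u $ 1} \<times> box (Complex (l $ 2) (l $ 3)) (Complex (u $ 2) (u $ 3))"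
      by (auto simp: f_def mem_box_cart forall_3 in_box_complex_iff)
    moreover have "emeasure lborel ({l $ 1<..<u $ 1} \<times> box (Complex (l $ 2) (l $ 3)) (Complex (u $ 2) (u $ 3)))
        = ennreal ((u $ 1 - l $ 1) * ((u $ 2 - l $ 2) * (u $ 3 - l $ 3)))"
      using le by (simp add: lborel_prod[symmetric] lborel.emeasure_pair_measure_Times
          emeasure_lborel_box_eq Basis_complex_def ennreal_mult)
    moreover have "(\<Prod>b\<in>Basis. (u - l) \<bullet> b) = (u $ 1 - l $ 1) * ((u $ 2 - l $ 2) * (u $ 3 - l $ 3))"
    proof -
      have Basis_3: "(Basis :: (real ^ 3) set) = {axis 1 1, axis 2 1, axis 3 1}"
        by (auto simp: Basis_vec_def UNIV_3)
      show ?thesis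
        unfolding Basis_3 by (simp add: axis_eq_axis inner_axis)
    qed
    ultimately show "emeasure (distr lborel borel f) (box l u) = (\<Prod>b\<in>Basis. (u - l) \<bullet> b)"
      by (simp add: emeasure_distr)
  qed simp
  have C: "?C \<in> sets borel"
    by measurable
  have "f -` ?C = {-r<..<r} \<times> ball 0 r"
  proof -
    have "p \<in> f -` ?C \<longleftrightarrow> p \<in> {-r<..<r} \<times> ball 0 r" for p
      by (cases p) (simp add: f_def cmod_less_iff[OF assms] abs_less_iff minus_less_iff[of _ r] conj_ac)
    then show ?thesis
      by blast
  qed
  moreover have "emeasure lborel ?C = emeasure (distr lborel borel f) ?C"
    using \<open>lborel = distr lborel borel f\<close> by simp
  ultimately have "emeasure lborel ?C = emeasure lborel ({-r<..<r} \<times> ball (0 :: complex) r)"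
    using C by (simp add: emeasure_distr)
  also have "\<dots> = ennreal (2 * r) * ennreal (pi * r\<^sup>2)"
    using assms by (simp add: lborel_prod[symmetric] lborel.emeasure_pair_measure_Times emeasure_ball unit_ball_vol_2)
  also have "\<dots> = ennreal (2 * pi * r ^ 3)"
    using assms by (simp add: ennreal_mult[symmetric] power3_eq_cube power2_eq_square mult_ac)
  finally have *: "emeasure lebesgue ?C = ennreal (2 * pi * r ^ 3)"
    using C by simp
  then show "?C \<in> lmeasurable"
    using C by (simp add: fmeasurable_def)
  show "measure lebesgue ?C = 2 * pi * r ^ 3"
    using * assms by (simp add: measure_def)
qed

text \<open>For positive \<open>r\<close> the set is the preimage of a product of two balls under a
  linear map.\<close>

lemma convex_cylinder: "convex {v :: real ^ 3. \<bar>v $ 1\<bar> < r \<and> (v $ 2)\<^sup>2 + (v $ 3)\<^sup>2 < r\<^sup>2}"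
proof (cases "r > 0")
  case True
  define f :: "real ^ 3 \<Rightarrow> real \<times> complex" where "f v = (v $ 1, Complex (v $ 2) (v $ 3))" for v
  have "linear f"
    by (auto simp: f_def linear_iff complex_eq_iff)
  have "{v :: real ^ 3. \<bar>v $ 1\<bar> < r \<and> (v $ 2)\<^sup>2 + (v $ 3)\<^sup>2 < r\<^sup>2} = f -` (ball 0 r \<times> ball 0 r)"
    by (simp add: set_eq_iff f_def cmod_less_iff[OF True])
  then show ?thesis
    using \<open>linear f\<close> by (metis convex_Times convex_ball convex_linear_vimage)
next
  case False
  then have "{v :: real ^ 3. \<bar>v $ 1\<bar> < r \<and> (v $ 2)\<^sup>2 + (v $ 3)\<^sup>2 < r\<^sup>2} = {}"
    by auto
  then show ?thesis
    by (simp only: convex_empty)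
qed

text \<open>The lattice is the image of the integer vectors under \<open>A\<close>. Pulling
  \<open>C\<close> back by the inverse matrix divides its measure by the covolume
  \<open>\<bar>det A\<bar>\<close> and reduces to the integer lattice.\<close>

lemma minkowski_matrix:
  fixes A :: "real ^ 'n::{finite,wellorder} ^ 'n::_"
  assumes C: "C \<in> lmeasurable" and "convex C" and sym: "\<And>x. x \<in> C \<Longrightarrow> - x \<in> C"
    and det: "det A \<noteq> 0" and gt: "measure lebesgue C > 2 ^ CARD('n) * \<bar>det A\<bar>"
  obtains v where "A *v v \<in> C" "v \<noteq> 0" "\<And>i. v $ i \<in> \<int>"
proof -
  obtain B where AB: "A ** B = mat 1"
    using det by (meson invertible_det_nz invertible_def)
  have "det A * det B = 1"
    by (metis AB det_I det_mul)
  then have detB: "\<bar>det A\<bar> * \<bar>det B\<bar> = 1"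
    by (metis abs_1 abs_mult)
  define S where "S = (*v) B ` C"
  have S_iff: "A *v v \<in> C" if "v \<in> S" for v
    using that by (auto simp: S_def matrix_vector_mul_assoc AB)
  have S: "S \<in> lmeasurable" "measure lebesgue S = \<bar>det B\<bar> * measure lebesgue C"
    unfolding S_def using measurable_linear_image[OF matrix_vector_mul_linear C, of B]
      measure_linear_image[OF matrix_vector_mul_linear C, of B] by auto
  have "2 ^ CARD('n) * (\<bar>det A\<bar> * \<bar>det B\<bar>) < measure lebesgue C * \<bar>det B\<bar>"
    using gt detB by (metis abs_ge_zero mult.assoc mult_strict_right_mono order_le_less mult_zero_right zero_neq_one)
  then have "measure lebesgue S > 2 ^ CARD('n)"
    unfolding detB S by (simp add: mult.commute)
  moreover have "convex S"
    unfolding S_def by (intro convex_linear_image \<open>convex C\<close>) simp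
  moreover have "- v \<in> S" if "v \<in> S" for v
  proof -
    have "- (B *v x) = B *v (- x)" for x
      using linear_neg[OF matrix_vector_mul_linear, of B x] by simp
    then show ?thesis
      using that sym unfolding S_def by auto
  qed
  ultimately show ?thesis
    using minkowski_convex_body[of S] S that S_iff by metis
qed

section \<open>Arithmetic of the basis 1, \<open>al\<close>, \<open>be\<close>\<close>

locale pure_cubic =
  fixes h k :: nat
  assumes k_pos: "0 < k" and k_less_h: "k < h" and coprime: "coprime h k" and sqf: "squarefree h"
begin

abbreviation "al \<equiv> cbrt_m h k"
abbreviation "be \<equiv> cbrt_m' h k"

lemma h_pos: "0 < h"
  using k_less_h by simp

lemma al_cube: "al ^ 3 = real h * real k ^ 2"
  unfolding cbrt_m_def radicand_def by (simp add: odd_real_root_pow)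

lemma al_pos: "al > 0"
  using k_pos h_pos by (simp add: cbrt_m_def radicand_def)

text \<open>With \<open>al_al\<close> and \<open>be_be\<close> this gives the multiplication table
  of the basis, to which all later products are reduced.\<close>

lemma al_be: "al * be = real h * real k"
proof -
  have "al * be = root 3 ((real h * real k) ^ 3)"
    unfolding cbrt_m_def cbrt_m'_def radicand_def
    by (simp add: real_root_mult[symmetric] power2_eq_square power3_eq_cube mult_ac)
  also have "\<dots> = real h * real k"
    by (rule real_root_power_cancel) auto
  finally show ?thesis .
qed

lemma al_al: "al * al = real k * be"
proof -
  have "al * (al * al) = al * (real k * be)"
    using al_cube al_be by (simp add: power3_eq_cube power2_eq_square algebra_simps)
  then show ?thesis
    using al_pos by simp
qed

lemma be_be: "be * be = real h * al"
proof -
  have "al * (be * be) = al * (real h * al)"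
    by (simp only: al_be mult.assoc[symmetric]) (simp add: al_al mult.commute mult.left_commute)
  then show ?thesis
    using al_pos by simp
qed

text \<open>Some prime \<open>r\<close> divides the radicand exactly once: it divides the squarefree
  \<open>h\<close> and not \<open>k\<close>. In the equation for \<open>p ^ 3\<close> the exponents
  of \<open>r\<close> on the two sides then differ modulo 3.\<close>

lemma al_irrational: "al \<notin> \<rat>"
proof
  assume "al \<in> \<rat>"
  then obtain p q :: nat where pq: "q \<noteq> 0" "al = real p / real q"
    using al_pos by (metis Rats_abs_nat_div_natE abs_of_pos)
  have "real (p ^ 3) = real (h * k\<^sup>2 * q ^ 3)"
    using al_cube pq by (simp add: field_simps)
  then have eq: "p ^ 3 = h * k\<^sup>2 * q ^ 3"
    by (simp only: of_nat_eq_iff)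
  have p: "p \<noteq> 0"
    using pq al_pos by (intro notI) simp
  \<comment> \<open>Such a prime exists because \<open>0 < k < h\<close> excludes
    \<open>h = 1\<close>.\<close>
  obtain r where r: "prime r" "r dvd h"
    using k_pos k_less_h prime_factor_nat[of h] by auto
  have "\<not> r dvd k"
    using r coprime by (meson coprime_common_divisor not_prime_unit)
  moreover have "multiplicity r h = 1"
  proof -
    have "\<not> r ^ 2 dvd h"
      using sqf r by (metis not_prime_unit squarefree_def)
    then have "multiplicity r h < 2"
      using r h_pos by (intro multiplicity_lessI) auto
    moreover have "multiplicity r h > 0"
      using r h_pos by (simp add: prime_multiplicity_gt_zero_iff)
    ultimately show ?thesis
      by simp
  qed
  ultimately have "3 * multiplicity r p = 1 + 3 * multiplicity r q"
    using r pq p h_pos k_pos arg_cong[OF eq, of "multiplicity r"]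
    by (simp add: prime_elem_multiplicity_mult_distrib prime_elem_multiplicity_power_distrib not_dvd_imp_multiplicity_0)
  then show False
    by presburger
qed

text \<open>Irrationality of \<open>al\<close> does the work: eliminating \<open>be\<close> leaves a
  relation linear in \<open>al\<close> with rational coefficients, and these must vanish.\<close>

lemma lin_indep:
  assumes "x \<in> \<rat>" "y \<in> \<rat>" "z \<in> \<rat>" and eq: "x + y * al + z * be = 0"
  shows "x = 0" "y = 0" "z = 0"
proof -
  text \<open>Multiply by \<open>al\<close>, then eliminate \<open>be\<close> between the two relations.\<close>
  have "al * (x + y * al + z * be) = 0"
    using eq by simp
  then have rel: "x * al + y * (real k * be) + z * (real h * real k) = 0"
    by (simp add: al_al[symmetric] al_be[symmetric] algebra_simps)
  have "z * x * al + y * real k * (z * be) + z * z * (real h * real k)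
      = z * (x * al + y * (real k * be) + z * (real h * real k))"
    by (simp add: algebra_simps)
  moreover have "z * be = - x - y * al"
    using eq by simp
  ultimately have "z * x * al + y * real k * (- x - y * al) + z * z * (real h * real k) = 0"
    using rel by simp
  then have lin: "(z * x - y * y * real k) * al = x * y * real k - z * z * real h * real k"
    by (simp add: algebra_simps)
  have zx: "z * x - y * y * real k = 0"
  proof (rule ccontr)
    assume nz: "z * x - y * y * real k \<noteq> 0"
    then have "al = (x * y * real k - z * z * real h * real k) / (z * x - y * y * real k)"
      using lin by (simp add: field_simps)
    also have "\<dots> \<in> \<rat>"
      using assms by auto
    finally show False
      using al_irrational by simp
  qed
  then have xy: "x * y = z * z * real h"
    using lin k_pos by simp
  have z0: "z = 0"
  proof (rule ccontr)
    assume "z \<noteq> 0"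
    \<comment> \<open>The two vanishing coefficients make \<open>y * real k / z\<close> a rational
      cube root of the radicand, hence equal to \<open>al\<close>.\<close>
    have "(y * real k) ^ 3 = (z * al) ^ 3"
    proof -
      have "(y * real k) ^ 3 = real k ^ 2 * y * (y * y * real k)"
        by (simp add: power3_eq_cube power2_eq_square)
      also have "\<dots> = real k ^ 2 * z * (x * y)"
        using zx by simp
      also have "\<dots> = z ^ 3 * (real h * real k ^ 2)"
        by (simp add: xy power3_eq_cube)
      finally show ?thesis
        by (simp add: power_mult_distrib al_cube)
    qed
    then have "y * real k = z * al"
      by (metis odd_numeral odd_real_root_power_cancel)
    then have "al = y * real k / z"
      using \<open>z \<noteq> 0\<close> by (simp add: field_simps)
    also have "\<dots> \<in> \<rat>"
      using assms by auto
    finally show False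
      using al_irrational by simp
  qed
  then show "z = 0" .
  show "y = 0"
    using zx z0 k_pos by simp
  then show "x = 0"
    using eq z0 by simp
qed

lemma lin_indep_eq:
  assumes "x \<in> \<rat>" "y \<in> \<rat>" "z \<in> \<rat>" "x' \<in> \<rat>" "y' \<in> \<rat>" "z' \<in> \<rat>"
    and eq: "x + y * al + z * be = x' + y' * al + z' * be"
  shows "x = x'" "y = y'" "z = z'"
  using lin_indep[of "x - x'" "y - y'" "z - z'"] assms by (auto simp: algebra_simps)

lemma mult_coords:
  "(x + y * al + z * be) * (x' + y' * al + z' * be) =
     (x * x' + y * z' * h * k + z * y' * h * k) + (x * y' + y * x' + z * z' * h) * al
     + (x * z' + z * x' + y * y' * k) * be"
proof -
  \<comment> \<open>Expanding with free \<open>a\<close> and \<open>b\<close> keeps the products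
    \<open>a * a\<close>, \<open>a * b\<close> and \<open>b * b\<close> visible, so that the
    multiplication table can rewrite them.\<close>
  have "(x + y * a + z * b) * (x' + y' * a + z' * b) = x * x' + (x * y' + y * x') * a + (x * z' + z * x') * b
      + y * y' * (a * a) + (y * z' + z * y') * (a * b) + z * z' * (b * b)" for a b
    by (simp add: algebra_simps)
  from this[of al be] show ?thesis
    unfolding al_al al_be be_be by (simp add: algebra_simps)
qed

section \<open>The generated field in coordinates\<close>

text \<open>This allows the record operations in the rules of \<open>generate_field\<close> to be
  identified with ordinary negation and inverse.\<close>

lemma ring_on_UNIV_field: "field (ring_on (UNIV :: real set))"
proof -
  have "\<exists>y. y * x = 1" if "x \<noteq> 0" for x :: real
    using that by (intro exI[of _ "inverse x"]) simp
  then show ?thesis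
    by unfold_locales (auto simp: ring_on_def Units_def algebra_simps intro: exI[of _ "- x" for x])
qed

lemma a_inv_ring_on: "\<ominus>\<^bsub>ring_on (UNIV :: real set)\<^esub> x = - x"
proof -
  interpret field "ring_on (UNIV :: real set)"
    by (rule ring_on_UNIV_field)
  show ?thesis
    by (rule minus_equality[of _ x]) (auto simp: ring_on_def)
qed

lemma m_inv_ring_on: "x \<noteq> 0 \<Longrightarrow> inv\<^bsub>ring_on (UNIV :: real set)\<^esub> x = inverse x"
proof -
  interpret field "ring_on (UNIV :: real set)"
    by (rule ring_on_UNIV_field)
  assume "x \<noteq> 0"
  then show ?thesis
    by (intro comm_inv_char) (auto simp: ring_on_def)
qed

lemma cubic_field_closed:
  shows "1 \<in> cubic_field h k" "al \<in> cubic_field h k"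
    and "x \<in> cubic_field h k \<Longrightarrow> - x \<in> cubic_field h k"
    and "x \<in> cubic_field h k \<Longrightarrow> y \<in> cubic_field h k \<Longrightarrow> x + y \<in> cubic_field h k"
    and "x \<in> cubic_field h k \<Longrightarrow> y \<in> cubic_field h k \<Longrightarrow> x * y \<in> cubic_field h k"
    and "x \<in> cubic_field h k \<Longrightarrow> x \<noteq> 0 \<Longrightarrow> inverse x \<in> cubic_field h k"
  using generate_field.one[of "ring_on UNIV" "{al}"] generate_field.incl[of al "{al}" "ring_on UNIV"]
    generate_field.a_inv[of x "ring_on UNIV" "{al}"] generate_field.m_inv[of x "ring_on UNIV" "{al}"]
    generate_field.eng_add[of x "ring_on UNIV" "{al}" y]  generate_field.eng_mult[of x "ring_on UNIV" "{al}" y]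
    a_inv_ring_on m_inv_ring_on
  unfolding cubic_field_def by (auto simp: ring_on_def)

lemma Rats_cubic_field:
  assumes "x \<in> \<rat>"
  shows "x \<in> cubic_field h k"
proof -
  have nat: "real n \<in> cubic_field h k" for n
  proof (induction n)
    case 0
    have "1 + - 1 \<in> cubic_field h k"
      using cubic_field_closed by blast
    then show ?case by simp
  qed (use cubic_field_closed in auto)
  have int: "real_of_int n \<in> cubic_field h k" for n
    using nat cubic_field_closed(3) by (cases n rule: int_cases2) auto
  obtain a b where "b > 0" "x = of_int a / of_int b"
    using assms by (auto elim: Rats_cases')
  then show ?thesis
    using int[of a] int[of b] by (auto simp: divide_inverse intro!: cubic_field_closed)
qed

lemma be_in_cubic_field: "be \<in> cubic_field h k"
proof -
  have "be = al * al * inverse (real k)"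
    using al_al k_pos by (simp add: field_simps)
  then show ?thesis
    using cubic_field_closed Rats_cubic_field by simp
qed

text \<open>The substantial point is that the rational span is closed under inverses, which follows
  by dividing the product of the other two conjugates by the norm.\<close>

lemma cubic_field_eq: "cubic_field h k = {x + y * al + z * be | x y z. x \<in> \<rat> \<and> y \<in> \<rat> \<and> z \<in> \<rat>}"
proof (intro equalityI subsetI)
  fix v assume "v \<in> {x + y * al + z * be | x y z. x \<in> \<rat> \<and> y \<in> \<rat> \<and> z \<in> \<rat>}"
  then obtain x y z where v: "v = x + y * al + z * be" "x \<in> \<rat>" "y \<in> \<rat>" "z \<in> \<rat>"
    by blast
  then show "v \<in> cubic_field h k"
    using Rats_cubic_field be_in_cubic_field by (auto intro!: cubic_field_closed)
next
  fix v assume "v \<in> cubic_field h k"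
  then show "v \<in> {x + y * al + z * be | x y z. x \<in> \<rat> \<and> y \<in> \<rat> \<and> z \<in> \<rat>}"
    unfolding cubic_field_def
  proof (induction rule: generate_field.induct)
    case one
    show ?case
      by (intro CollectI exI[of _ 1] exI[of _ 0]) (auto simp: ring_on_def)
  next
    case (incl v)
    then show ?case
      by (intro CollectI exI[of _ 1] exI[of _ 0]) auto
  next
    case (a_inv v)
    then obtain x y z where v: "v = x + y * al + z * be" "x \<in> \<rat>" "y \<in> \<rat>" "z \<in> \<rat>"
      by blast
    show ?case
      by (intro CollectI exI[of _ "-x"] exI[of _ "-y"] exI[of _ "-z"])
        (use v in \<open>auto simp: a_inv_ring_on algebra_simps\<close>)
  next
    case (m_inv v)
    then obtain x y z where v: "v = x + y * al + z * be" "x \<in> \<rat>" "y \<in> \<rat>" "z \<in> \<rat>"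
      by blast
    have "v \<noteq> 0"
      using m_inv by (auto simp: ring_on_def)
    \<comment> \<open>\<open>s\<close> is the product of the two other conjugates of
      \<open>v\<close>, and \<open>n\<close> is the norm of \<open>v\<close>.\<close>
    define s where "s = (x * x - y * z * h * k) + (z * z * h - x * y) * al + (y * y * k - x * z) * be"
    define n where "n = x ^ 3 + y ^ 3 * h * (real k)\<^sup>2 + z ^ 3 * (real h)\<^sup>2 * k - 3 * x * y * z * h * k"
    have vs: "v * s = n"
    proof -
      have expand: "(x + y * a + z * b) * (p + q * a + r * b) = x * p + (x * q + y * p) * a + (x * r + z * p) * b
          + y * q * (a * a) + (y * r + z * q) * (a * b) + z * r * (b * b)" for a b p q r
        by (simp add: algebra_simps)
      show ?thesis
        unfolding v(1) s_def n_def expand al_al al_be be_be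
        by (simp add: algebra_simps power2_eq_square power3_eq_cube)
    qed
    have "n \<noteq> 0"
    proof
      assume "n = 0"
      then have "s = 0"
        using vs \<open>v \<noteq> 0\<close> by simp
      \<comment> \<open>The other conjugates are complex conjugate, so \<open>s\<close> is a squared
        modulus; the two squares come from its real and imaginary parts.\<close>
      have "4 * s = (2 * x - y * al - z * be)\<^sup>2 + 3 * (y * al - z * be)\<^sup>2"
      proof -
        have "(2 * x - y * a - z * b)\<^sup>2 + 3 * (y * a - z * b)\<^sup>2 = 4 * (x * x) - 4 * x * y * a - 4 * x * z * b
            + 4 * y * y * (a * a) - 4 * y * z * (a * b) + 4 * z * z * (b * b)" for a b
          by (simp add: algebra_simps power2_eq_square)
        from this[of al be] show ?thesis
          unfolding s_def al_al al_be be_be by (simp add: algebra_simps)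
      qed
      then have "2 * x - y * al - z * be = 0" "y * al - z * be = 0"
        using \<open>s = 0\<close> by (auto simp: sum_power2_eq_zero_iff add_nonneg_eq_0_iff)
      then have eq: "x + - y * al + 0 * be = 0" "x + 0 * al + - z * be = 0"
        by simp_all
      then have "x = 0" "y = 0" "z = 0"
        using lin_indep[of x "- y" 0] lin_indep[of x 0 "- z"] v by auto
      then show False
        using v \<open>v \<noteq> 0\<close> by simp
    qed
    have "n \<in> \<rat>"
      using v unfolding n_def by auto
    have "inverse v = s / n"
      using vs \<open>v \<noteq> 0\<close> \<open>n \<noteq> 0\<close> by (simp add: field_simps)
    then have "inverse v = (x * x - y * z * h * k) / n + (z * z * h - x * y) / n * al + (y * y * k - x * z) / n * be"
      unfolding s_def by (simp add: add_divide_distrib)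
    then show ?case
      using v \<open>n \<in> \<rat>\<close> \<open>v \<noteq> 0\<close>
      by (intro CollectI exI[of _ "(x * x - y * z * h * k) / n"] exI[of _ "(z * z * h - x * y) / n"] exI[of _ "(y * y * k - x * z) / n"])
        (simp add: m_inv_ring_on)
  next
    case (eng_add v w)
    then obtain x y z x' y' z' where v: "v = x + y * al + z * be" "x \<in> \<rat>" "y \<in> \<rat>" "z \<in> \<rat>"
      "w = x' + y' * al + z' * be" "x' \<in> \<rat>" "y' \<in> \<rat>" "z' \<in> \<rat>"
      by blast
    show ?case
      by (intro CollectI exI[of _ "x + x'"] exI[of _ "y + y'"] exI[of _ "z + z'"])
        (use v in \<open>auto simp: ring_on_def algebra_simps\<close>)
  next
    case (eng_mult v w)
    then obtain x y z x' y' z' where v: "v = x + y * al + z * be" "x \<in> \<rat>" "y \<in> \<rat>" "z \<in> \<rat>"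
      "w = x' + y' * al + z' * be" "x' \<in> \<rat>" "y' \<in> \<rat>" "z' \<in> \<rat>"
      by blast
    have "v * w = (x * x' + y * z' * h * k + z * y' * h * k) + (x * y' + y * x' + z * z' * h) * al
        + (x * z' + z * x' + y * y' * k) * be"
      unfolding v by (rule mult_coords)
    then show ?case
      by (intro CollectI exI[of _ "x * x' + y * z' * h * k + z * y' * h * k"]
          exI[of _ "x * y' + y * x' + z * z' * h"] exI[of _ "x * z' + z * x' + y * y' * k"])
        (use v in \<open>auto simp: ring_on_def\<close>)
  qed
qed

section \<open>Complex embeddings and the shadow\<close>

abbreviation "K \<equiv> cubic_field h k"

text \<open>For a cube root of unity \<zeta> this is the embedding sending \<open>al\<close> to
  \<zeta> times \<open>al\<close>; the square at \<open>be\<close> is forced by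
  \<open>al * al = real k * be\<close>. The description is unambiguous because coordinates are
  unique.\<close>

definition emb :: "complex \<Rightarrow> real \<Rightarrow> complex" where
  "emb \<zeta> = restrict (\<lambda>v. THE w. \<exists>x\<in>\<rat>. \<exists>y\<in>\<rat>. \<exists>z\<in>\<rat>. v = x + y * al + z * be \<and>
     w = of_real x + of_real (y * al) * \<zeta> + of_real (z * be) * \<zeta>\<^sup>2) K"

lemma emb_eval:
  assumes "x \<in> \<rat>" "y \<in> \<rat>" "z \<in> \<rat>"
  shows "emb \<zeta> (x + y * al + z * be) = of_real x + of_real (y * al) * \<zeta> + of_real (z * be) * \<zeta>\<^sup>2"
proof -
  have "x + y * al + z * be \<in> K"
    using assms cubic_field_eq by blast
  moreover have "(THE w. \<exists>x'\<in>\<rat>. \<exists>y'\<in>\<rat>. \<exists>z'\<in>\<rat>. x + y * al + z * be = x' + y' * al + z' * be \<and>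
     w = of_real x' + of_real (y' * al) * \<zeta> + of_real (z' * be) * \<zeta>\<^sup>2)
      = of_real x + of_real (y * al) * \<zeta> + of_real (z * be) * \<zeta>\<^sup>2"
    (is "The ?P = ?w")
  proof (rule the_equality)
    show "?P ?w"
      using assms by blast
    fix w assume "?P w"
    then obtain x' y' z' where rat: "x' \<in> \<rat>" "y' \<in> \<rat>" "z' \<in> \<rat>"
      and eq: "x + y * al + z * be = x' + y' * al + z' * be"
      and w: "w = of_real x' + of_real (y' * al) * \<zeta> + of_real (z' * be) * \<zeta>\<^sup>2"
      by blast
    show "w = ?w"
      unfolding w lin_indep_eq[OF assms rat eq] by (rule refl)
  qed
  ultimately show ?thesis
    by (simp add: emb_def)
qed

text \<open>Giving 1, \<open>al\<close>, \<open>be\<close> the weights 0, 1, 2 makes the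
  multiplication table homogeneous modulo 3, so twisting by powers of \<zeta> is
  multiplicative.\<close>

lemma emb_in_embeddings:
  assumes "\<zeta> ^ 3 = 1"
  shows "emb \<zeta> \<in> embeddings K"
proof -
  have "emb \<zeta> (v * w) = emb \<zeta> v * emb \<zeta> w" "emb \<zeta> (v + w) = emb \<zeta> v + emb \<zeta> w" if vw: "v \<in> K" "w \<in> K" for v w
  proof -
    from vw obtain x y z x' y' z' where v: "v = x + y * al + z * be" "x \<in> \<rat>" "y \<in> \<rat>" "z \<in> \<rat>"
      and w: "w = x' + y' * al + z' * be" "x' \<in> \<rat>" "y' \<in> \<rat>" "z' \<in> \<rat>"
      unfolding cubic_field_eq by blast
    have "v + w = (x + x') + (y + y') * al + (z + z') * be"
      using v w by (simp add: algebra_simps)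
    then have "emb \<zeta> (v + w) = of_real (x + x') + of_real ((y + y') * al) * \<zeta> + of_real ((z + z') * be) * \<zeta>\<^sup>2"
      using v w by (simp only: emb_eval Rats_add)
    then show "emb \<zeta> (v + w) = emb \<zeta> v + emb \<zeta> w"
      unfolding v(1) w(1) using v w by (simp only: emb_eval) (simp add: algebra_simps)
    have ev: "emb \<zeta> (v * w) = of_real (x * x' + y * z' * h * k + z * y' * h * k)
        + of_real ((x * y' + y * x' + z * z' * h) * al) * \<zeta> + of_real ((x * z' + z * x' + y * y' * k) * be) * \<zeta>\<^sup>2"
      unfolding v(1) w(1) mult_coords using v w by (intro emb_eval) auto
    define a b :: complex where ab: "a = of_real al" "b = of_real be"
    have expand: "(X + Y * a * \<zeta> + Z * b * \<zeta>\<^sup>2) * (X' + Y' * a * \<zeta> + Z' * b * \<zeta>\<^sup>2) =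
       X * X' + (X * Y' + Y * X') * a * \<zeta> + (X * Z' + Z * X') * b * \<zeta>\<^sup>2
      + Y * Y' * (a * a) * \<zeta>\<^sup>2 + (Y * Z' + Z * Y') * (a * b) * \<zeta> ^ 3 + Z * Z' * (b * b) * (\<zeta> ^ 3 * \<zeta>)"
      for X Y Z X' Y' Z'
      by (simp add: algebra_simps power2_eq_square power3_eq_cube)
    have rel: "a * a = of_nat k * b" "a * b = of_nat h * of_nat k" "b * b = of_nat h * a"
      unfolding ab using al_al al_be be_be by (metis of_real_mult of_real_of_nat_eq)+
    have "emb \<zeta> v * emb \<zeta> w =
        (of_real x + of_real y * a * \<zeta> + of_real z * b * \<zeta>\<^sup>2) * (of_real x' + of_real y' * a * \<zeta> + of_real z' * b * \<zeta>\<^sup>2)"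
      using v w by (simp add: emb_eval ab)
    then show "emb \<zeta> (v * w) = emb \<zeta> v * emb \<zeta> w"
      unfolding expand rel assms ev by (simp add: ab algebra_simps)
  qed
  moreover have "emb \<zeta> 1 = 1"
    using emb_eval[of 1 0 0] by simp
  ultimately show ?thesis
    unfolding embeddings_def by (auto simp: ring_on_def emb_def intro!: ring_hom_memI)
qed

text \<open>An embedding fixes the rationals, so it fixes the cube of \<open>al\<close> and
  multiplies \<open>al\<close> by a cube root of unity. Its value at \<open>be\<close> then follows
  from \<open>al_al\<close>.\<close>

lemma embeddings_imp_emb:
  assumes "\<tau> \<in> embeddings K"
  obtains \<zeta> where "\<zeta> ^ 3 = 1" "\<tau> = emb \<zeta>"
proof -
  have add: "\<tau> (v + w) = \<tau> v + \<tau> w" and mult: "\<tau> (v * w) = \<tau> v * \<tau> w" if "v \<in> K" "w \<in> K" for v w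
    using assms that unfolding embeddings_def ring_on_def ring_hom_def by auto
  have one: "\<tau> 1 = 1" and ext: "\<tau> \<in> extensional K"
    using assms unfolding embeddings_def ring_on_def ring_hom_def by auto
  have zero: "\<tau> 0 = 0"
    using add[of 0 0] Rats_cubic_field[of 0] by simp
  have nat: "\<tau> (real n) = of_nat n" for n
  proof (induction n)
    case (Suc n)
    then show ?case
      using add[of 1 "real n"] one Rats_cubic_field by simp
  qed (simp add: zero)
  have int: "\<tau> (real_of_int n) = of_int n" for n
  proof (cases n rule: int_cases2)
    case (nonpos m)
    then show ?thesis
      using add[of "real m" "- real m"] nat[of m] zero Rats_cubic_field by (simp add: add_eq_0_iff)
  qed (simp add: nat)
  have rat: "\<tau> x = of_real x" if x: "x \<in> \<rat>" for x
  proof -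
    obtain a b where ab: "b > 0" "x = of_int a / of_int b"
      using x by (auto elim: Rats_cases')
    then have "of_int b * x = of_int a"
      by simp
    then have "of_int b * \<tau> x = of_int a"
      using mult[of "of_int b" x] int x Rats_cubic_field by (metis Rats_of_int)
    then have "\<tau> x = of_int a / of_int b"
      using ab(1) by (simp add: eq_divide_eq mult.commute)
    also have "\<dots> = of_real x"
      by (simp add: ab(2))
    finally show ?thesis .
  qed
  define \<zeta> where "\<zeta> = \<tau> al / of_real al"
  have al: "\<tau> al = of_real al * \<zeta>"
    using al_pos by (simp add: \<zeta>_def)
  have K: "al \<in> K" "be \<in> K" "0 \<in> K"
    using cubic_field_closed be_in_cubic_field Rats_cubic_field by auto
  have "\<tau> (al ^ 3) = \<tau> al ^ 3"
    using mult K cubic_field_closed by (simp add: power3_eq_cube)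
  then have "of_real (al ^ 3) = (of_real al * \<zeta>) ^ 3"
    using rat[of "real h * real k ^ 2"] by (simp add: al al_cube)
  then have z3: "\<zeta> ^ 3 = 1"
    using al_pos by (simp add: power_mult_distrib)
  have "\<tau> (real k * be) = \<tau> (al * al)"
    by (simp add: al_al)
  then have "of_nat k * \<tau> be = of_real (al * al) * \<zeta>\<^sup>2"
    using mult K nat Rats_cubic_field by (simp add: al power2_eq_square mult_ac)
  then have be: "\<tau> be = of_real be * \<zeta>\<^sup>2"
    unfolding al_al using k_pos by simp
  have "\<tau> v = emb \<zeta> v" for v
  proof (cases "v \<in> K")
    case True
    then obtain x y z where v: "v = x + y * al + z * be" "x \<in> \<rat>" "y \<in> \<rat>" "z \<in> \<rat>"
      unfolding cubic_field_eq by blast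
    then show ?thesis
      using K Rats_cubic_field cubic_field_closed
      by (simp add: emb_eval add mult rat al be)
  next
    case False
    then show ?thesis
      using ext by (simp add: emb_def extensional_def)
  qed
  then show ?thesis
    using that z3 by blast
qed

text \<open>The two embeddings other than the inclusion are complex conjugate, so the shadow is the
  squared modulus of either value. This turns the shadow condition into membership in a
  disc.\<close>

lemma cmod_shadow:
  assumes "x \<in> \<rat>" "y \<in> \<rat>" "z \<in> \<rat>"
  shows "cmod (shadow K (x + y * al + z * be)) = (x - (y * al + z * be) / 2)\<^sup>2 + (sqrt 3 / 2 * (y * al - z * be))\<^sup>2"
proof -
  define w where "w = Complex (- 1 / 2) (sqrt 3 / 2)"
  have w2: "w\<^sup>2 = cnj w" and w3: "w ^ 3 = 1" "cnj w ^ 3 = 1"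
    by (auto simp: w_def power2_eq_square power3_eq_cube complex_eq_iff)
  have roots: "\<zeta> = 1 \<or> \<zeta> = w \<or> \<zeta> = cnj w" if "\<zeta> ^ 3 = 1" for \<zeta>
  proof -
    have "(\<zeta> - 1) * ((\<zeta> - w) * (\<zeta> - cnj w)) = \<zeta> ^ 3 - 1"
      by (simp add: w_def complex_eq_iff power3_eq_cube algebra_simps)
    then show ?thesis
      using that by auto
  qed
  have id: "emb 1 = restrict complex_of_real K"
  proof
    fix v show "emb 1 v = restrict complex_of_real K v"
    proof (cases "v \<in> K")
      case True
      then obtain x y z where v: "v = x + y * al + z * be" "x \<in> \<rat>" "y \<in> \<rat>" "z \<in> \<rat>"
        unfolding cubic_field_eq by blast
      then show ?thesis
        using True by (simp add: emb_eval)
    qed (simp add: emb_def)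
  qed
  \<comment> \<open>The value at \<open>al\<close> recovers \<zeta>. Hence the three embeddings are
    distinct, which matters because the shadow is a product over a set.\<close>
  have "emb \<zeta> al = of_real al * \<zeta>" for \<zeta>
    using emb_eval[of 0 1 0] by simp
  then have inj: "\<zeta> = \<zeta>'" if "emb \<zeta> = emb \<zeta>'" for \<zeta> \<zeta>'
    using that al_pos by (metis mult_left_cancel of_real_eq_0_iff order_less_irrefl)
  have "embeddings K = {emb 1, emb w, emb (cnj w)}"
    using roots w3 by (auto intro: emb_in_embeddings elim!: embeddings_imp_emb)
  moreover have "1 \<noteq> w" "1 \<noteq> cnj w" "w \<noteq> cnj w"
    by (auto simp: w_def complex_eq_iff)
  ultimately have "embeddings K - {restrict complex_of_real K} = {emb w, emb (cnj w)}" "emb w \<noteq> emb (cnj w)"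
    unfolding id[symmetric] using inj by blast+
  then have "shadow K (x + y * al + z * be) = emb w (x + y * al + z * be) * emb (cnj w) (x + y * al + z * be)"
    by (simp add: shadow_def)
  also have "emb (cnj w) (x + y * al + z * be) = cnj (emb w (x + y * al + z * be))"
    using assms by (simp add: emb_eval)
  finally have "cmod (shadow K (x + y * al + z * be)) = (cmod (emb w (x + y * al + z * be)))\<^sup>2"
    by (simp add: norm_mult power2_eq_square)
  also have "emb w (x + y * al + z * be) = Complex (x - (y * al + z * be) / 2) (sqrt 3 / 2 * (y * al - z * be))"
    using assms by (simp add: emb_eval w2) (simp add: w_def complex_eq_iff algebra_simps)
  finally show ?thesis
    by (simp add: cmod_power2)
qed

section \<open>Canonical forms: coordinates, leading coefficients and length\<close>

lemma sigma_pos: "sigma h k > 0"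
  by (simp add: sigma_def)

text \<open>The integer \<open>t\<close> is the sign in \<open>theta\<close>; hiding its value
  treats both cases at once.\<close>

lemma theta_coords:
  obtains t :: int where "theta h k = real k / sigma h k + t * k / sigma h k * al + 1 / sigma h k * be"
proof (cases "[int (radicand h k) = - 1] (mod 9)")
  case True
  then show ?thesis
    using that[of "-1"] by (simp add: theta_def add_divide_distrib diff_divide_distrib)
next
  case False
  then show ?thesis
    using that[of 1] by (simp add: theta_def add_divide_distrib diff_divide_distrib)
qed

lemma generators_in_cubic_integers: "al \<in> cubic_integers h k" "be \<in> cubic_integers h k"
  using cubic_field_closed be_in_cubic_field
  by (auto simp: cubic_integers_def cbrt_m_def cbrt_m'_def simp del: of_nat_mult of_nat_power)

text \<open>By primitivity it suffices that \<open>c * f\<close> divides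
  \<open>sigma h k * a\<close> times each of the six coefficients. These divisibilities come from
  comparing coordinates of \<open>al * a\<close> and \<open>be * a\<close> with those of general
  ideal elements.\<close>

lemma leading_coeffs_dvd:
  assumes can: "canonical_form h k I a b c d e f"
    and I: "ideal I (ring_on (cubic_integers h k))" and gcd: "Gcd {a, b, c, d, e, f} = 1"
  shows "c * f dvd sigma h k * a"
proof -
  let ?s = "sigma h k"
  obtain t :: int where theta: "theta h k = real k / ?s + t * k / ?s * al + 1 / ?s * be"
    by (rule theta_coords)
  have pos: "a > 0" "c > 0" "f > 0"
    and I_eq: "I = {of_int x * of_int a + of_int y * (of_int b + of_int c * al)
          + of_int z * (of_int d + of_int e * al + of_int f * theta h k) | x y z :: int. True}"
    using can unfolding canonical_form_def by auto
  have rep: "\<exists>x y z :: int. v = (x * a + y * b + z * d + z * f * k / ?s) + (y * c + z * e + z * f * t * k / ?s) * al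
      + (z * f / ?s) * be" if v: "v \<in> I" for v
  proof -
    obtain x y z :: int where "v = real_of_int x * a + y * (b + c * al) + z * (d + e * al + f * theta h k)"
      using v unfolding I_eq by blast
    then have "v = (x * a + y * b + z * d + z * f * k / ?s) + (y * c + z * e + z * f * t * k / ?s) * al
      + (z * f / ?s) * be"
      unfolding theta by (simp add: algebra_simps)
    then show ?thesis
      by blast
  qed
  have "real_of_int a \<in> I"
    unfolding I_eq by (intro CollectI exI[of _ 1] exI[of _ 0]) auto
  text \<open>Multiplying by \<open>be\<close> rather than by \<open>theta h k\<close> avoids proving \<open>theta h k\<close> integral.\<close>
  then have aI: "al * a \<in> I" "be * a \<in> I"
    using ideal.I_l_closed[OF I] generators_in_cubic_integers by (auto simp: ring_on_def)
  obtain x1 y1 z1 :: int where "al * a = (x1 * a + y1 * b + z1 * d + z1 * f * k / ?s)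
      + (y1 * c + z1 * e + z1 * f * t * k / ?s) * al + (z1 * f / ?s) * be"
    using rep[OF aI(1)] by blast
  then have "0 + a * al + 0 * be = (x1 * a + y1 * b + z1 * d + z1 * f * k / ?s)
      + (y1 * c + z1 * e + z1 * f * t * k / ?s) * al + (z1 * f / ?s) * be"
    by (simp add: mult.commute)
  note c1 = lin_indep_eq[OF _ _ _ _ _ _ this]
  have "z1 = 0"
    using c1(3) pos sigma_pos by simp
  with c1(1,2) have "real_of_int (x1 * a + y1 * b) = real_of_int 0" "real_of_int a = real_of_int (y1 * c)"
    by simp_all
  then have e1: "x1 * a + y1 * b = 0" "a = y1 * c"
    by (simp_all only: of_int_eq_iff)
  obtain x y z :: int where "be * a = (x * a + y * b + z * d + z * f * k / ?s)
      + (y * c + z * e + z * f * t * k / ?s) * al + (z * f / ?s) * be"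
    using rep[OF aI(2)] by blast
  then have "0 + 0 * al + a * be = (x * a + y * b + z * d + z * f * k / ?s)
      + (y * c + z * e + z * f * t * k / ?s) * al + (z * f / ?s) * be"
    by (simp add: mult.commute)
  note c2 = lin_indep_eq[OF _ _ _ _ _ _ this]
  have az: "real_of_int a = z * f / ?s"
    using c2(3) by simp
  then have "real_of_int (?s * a) = real_of_int (f * z)"
    using sigma_pos by (simp add: field_simps)
  then have sa: "?s * a = f * z"
    by (simp only: of_int_eq_iff)
  have "z * f * k / ?s = real_of_int (a * k)" "z * f * t * k / ?s = real_of_int (a * t * k)"
    using az by simp_all
  with c2(1,2) have "real_of_int (x * a + y * b + z * d + a * k) = real_of_int 0"
    "real_of_int (y * c + z * e + a * t * k) = real_of_int 0"
    by simp_all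
  then have e2: "x * a + y * b + z * d + a * k = 0" "y * c + z * e + a * t * k = 0"
    by (simp_all only: of_int_eq_iff)
  have "y1 \<noteq> 0"
    using e1 pos by auto
  moreover have "y1 * (x1 * c + b) = 0"
    using e1 by (simp add: algebra_simps)
  ultimately have b: "b = - x1 * c"
    by simp
  \<comment> \<open>Since \<open>?s * a = f * z\<close>, the factor \<open>f\<close> is already
    present. The factor \<open>c\<close> divides \<open>a\<close> and \<open>b\<close> directly, but
    \<open>d\<close> and \<open>e\<close> only after multiplication by \<open>z\<close>.\<close>
  have zd: "z * d = - c * (x * y1 - y * x1 + y1 * k)" and ze: "z * e = - c * (y + y1 * t * k)"
    using e2 unfolding b e1(2) by (simp_all add: algebra_simps)
  have "c * f dvd ?s * a * a" "c * f dvd ?s * a * b" "c * f dvd ?s * a * c"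
    unfolding sa by (simp_all add: e1(2) b)
  moreover have "c * f dvd ?s * a * d"
  proof -
    have "?s * a * d = c * f * (- (x * y1 - y * x1 + y1 * k))"
      unfolding sa mult.assoc zd by (simp add: algebra_simps)
    then show ?thesis
      by (metis dvd_triv_left)
  qed
  moreover have "c * f dvd ?s * a * e"
  proof -
    have "?s * a * e = c * f * (- (y + y1 * t * k))"
      unfolding sa mult.assoc ze by (simp add: algebra_simps)
    then show ?thesis
      by (metis dvd_triv_left)
  qed
  moreover have "c * f dvd ?s * a * f"
    by (simp add: e1(2))
  ultimately have "c * f dvd Gcd ((*) (?s * a) ` {a, b, c, d, e, f})"
    by (intro Gcd_greatest) auto
  also have "Gcd ((*) (?s * a) ` {a, b, c, d, e, f}) = normalize (?s * a)"
    by (simp only: Gcd_mult gcd mult_1_right)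
  finally show ?thesis
    by simp
qed

text \<open>A rational integer has zero coordinates at \<open>al\<close> and \<open>be\<close>. The
  triangular shape of the basis then makes every one in \<open>I\<close> a multiple of
  \<open>a\<close>.\<close>

lemma canonical_form_le_length:
  assumes can: "canonical_form h k I a b c d e f"
  shows "a \<le> int (ideal_length I)"
proof -
  have pos: "a > 0" "c > 0" "f > 0"
    and I_eq: "I = {of_int x * of_int a + of_int y * (of_int b + of_int c * al)
          + of_int z * (of_int d + of_int e * al + of_int f * theta h k) | x y z :: int. True}"
    using can unfolding canonical_form_def by auto
  have "real_of_int a \<in> I"
    unfolding I_eq by (intro CollectI exI[of _ 1] exI[of _ 0]) auto
  \<comment> \<open>\<open>a\<close> is a witness for the \<open>LEAST\<close> in
    \<open>ideal_length\<close>, so the length itself lies in \<open>I\<close>.\<close>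
  then have "nat a > 0 \<and> real (nat a) \<in> I"
    using pos by simp
  then have L: "ideal_length I > 0 \<and> real (ideal_length I) \<in> I"
    unfolding ideal_length_def by (rule LeastI)
  obtain t :: int where theta: "theta h k = real k / sigma h k + t * k / sigma h k * al + 1 / sigma h k * be"
    by (rule theta_coords)
  obtain x y z :: int where "real (ideal_length I) = real_of_int x * a + y * (b + c * al) + z * (d + e * al + f * theta h k)"
    using L unfolding I_eq by blast
  then have "real (ideal_length I) + 0 * al + 0 * be = (x * a + y * b + z * d + z * f * k / sigma h k)
      + (y * c + z * e + z * f * t * k / sigma h k) * al + (z * f / sigma h k) * be"
    unfolding theta by (simp add: algebra_simps)
  note c = lin_indep_eq[OF _ _ _ _ _ _ this]
  have "z = 0"
    using c(3) pos sigma_pos by simp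
  moreover from this have "y = 0"
    using c(2) pos by simp
  ultimately have "real_of_int (int (ideal_length I)) = real_of_int (x * a)"
    using c(1) by simp
  then have eq: "int (ideal_length I) = x * a"
    by (simp only: of_int_eq_iff)
  then have "x > 0"
    using L pos by (metis of_nat_0_less_iff zero_less_mult_pos2)
  then show "a \<le> int (ideal_length I)"
    using eq pos by simp
qed

section \<open>Minkowski's theorem applied to the ideal\<close>

lemma not_reduced:
  assumes prim: "primitive_ideal h k I"
    and large: "real (ideal_length I) > 6 * sqrt 3 * real (radicand h k) / pi"
  shows "\<not> reduced_ideal h k I"
proof
  assume red: "reduced_ideal h k I"
  let ?s = "sigma h k"
  define L where "L = real (ideal_length I)"
  obtain a b c d e f where can: "canonical_form h k I a b c d e f"
    and I: "ideal I (ring_on (cubic_integers h k))" and gcd: "Gcd {a, b, c, d, e, f} = 1"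
    using prim unfolding primitive_ideal_def by blast
  have pos: "a > 0" "c > 0" "f > 0"
    and I_eq: "I = {of_int x * of_int a + of_int y * (of_int b + of_int c * al)
          + of_int z * (of_int d + of_int e * al + of_int f * theta h k) | x y z :: int. True}"
    using can unfolding canonical_form_def by auto
  obtain t :: int where theta: "theta h k = real k / ?s + t * k / ?s * al + 1 / ?s * be"
    by (rule theta_coords)
  have aL: "real_of_int a \<le> L"
    using canonical_form_le_length[OF can] unfolding L_def by linarith
  then have Lpos: "L > 0"
    using pos by linarith
  define C where "C = {v :: real ^ 3. \<bar>v $ 1\<bar> < L \<and> (v $ 2)\<^sup>2 + (v $ 3)\<^sup>2 < L\<^sup>2}"
  \<comment> \<open>\<open>E\<close> sends coordinates over 1, \<open>al\<close>, \<open>be\<close>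
    to the real value and to the real and imaginary parts of a complex conjugate, as in
    \<open>cmod_shadow\<close>. The columns of \<open>B\<close> are the coordinates of the canonical
    basis, so \<open>E ** B\<close> maps integer vectors onto the embedded ideal.\<close>
  define E :: "real ^ 3 ^ 3" where "E = vector [vector [1, al, be],
     vector [1, - al / 2, - be / 2], vector [0, sqrt 3 / 2 * al, - sqrt 3 / 2 * be]]"
  define B :: "real ^ 3 ^ 3" where "B = vector [vector [of_int a, of_int b, d + f * k / ?s],
     vector [0, of_int c, e + f * t * k / ?s], vector [0, 0, f / ?s]]"
  have "det E = 3 * sqrt 3 / 2 * (al * be)"
    by (simp add: det_3 E_def field_simps)
  moreover have "det B = a * (c * f / ?s)"
    by (simp add: det_3 B_def)
  ultimately have det: "det (E ** B) = 3 * sqrt 3 / 2 * (real h * real k) * (a * (c * f / ?s))"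
    by (simp only: det_mul al_be)
  then have det_pos: "det (E ** B) > 0"
    using pos h_pos k_pos sigma_pos by simp
  have "c * f \<le> ?s * a"
    using leading_coeffs_dvd[OF can I gcd] pos sigma_pos by (intro zdvd_imp_le) auto
  then have "real_of_int (c * f) \<le> real_of_int (?s * a)"
    by (simp only: of_int_le_iff)
  then have cf: "c * f / ?s \<le> real_of_int a"
    using sigma_pos by (simp add: field_simps)
  \<comment> \<open>Both \<open>a\<close> and \<open>c * f / ?s\<close> are at most
    \<open>L\<close>. The chain then enlarges \<open>h * k\<close> to the radicand and uses the
    bound on \<open>L\<close> to reach the cylinder volume.\<close>
  have "2 ^ 3 * det (E ** B) \<le> 2 ^ 3 * (3 * sqrt 3 / 2 * (real h * real k) * (L * L))"
    unfolding det using cf aL pos sigma_pos by (intro mult_left_mono mult_mono) auto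
  also have "\<dots> \<le> 12 * sqrt 3 * (real h * (real k)\<^sup>2) * (L * L)"
  proof -
    have "real h * real k \<le> real h * (real k)\<^sup>2"
      using k_pos by (intro mult_left_mono self_le_power) auto
    then have "12 * sqrt 3 * (real h * real k) * (L * L) \<le> 12 * sqrt 3 * (real h * (real k)\<^sup>2) * (L * L)"
      by (intro mult_right_mono[OF mult_left_mono]) auto
    moreover have "2 ^ 3 * (3 * sqrt 3 / 2 * (real h * real k) * (L * L)) = 12 * sqrt 3 * (real h * real k) * (L * L)"
      by simp
    ultimately show ?thesis
      by (simp only:)
  qed
  also have "\<dots> = 2 * (6 * sqrt 3 * real (radicand h k)) * (L * L)"
    by (simp add: radicand_def)
  also have "\<dots> < 2 * (pi * L) * (L * L)"
    using large Lpos unfolding L_def[symmetric]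
    by (intro mult_strict_right_mono) (simp_all add: field_simps)
  also have "\<dots> = measure lebesgue C"
    unfolding C_def measure_cylinder(2)[OF Lpos] by (simp add: power3_eq_cube)
  finally have "measure lebesgue C > 2 ^ CARD(3) * \<bar>det (E ** B)\<bar>"
    using det_pos by simp
  moreover have "C \<in> lmeasurable" "convex C"
    unfolding C_def using measure_cylinder(1)[OF Lpos] convex_cylinder by auto
  moreover have "- v \<in> C" if "v \<in> C" for v
    using that by (simp add: C_def)
  ultimately obtain v where v: "(E ** B) *v v \<in> C" "v \<noteq> 0" "\<And>i. v $ i \<in> \<int>"
    using minkowski_matrix[of C "E ** B"] det_pos by (metis order_less_irrefl)
  obtain x y z :: int where xyz: "v $ 1 = x" "v $ 2 = y" "v $ 3 = z"
    using v(3) by (metis Ints_cases)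
  \<comment> \<open>\<open>X\<close>, \<open>Y\<close>, \<open>Z\<close> are the entries of
    \<open>B *v v\<close>, that is, the field coordinates of the ideal element with integer
    coefficients \<open>x\<close>, \<open>y\<close>, \<open>z\<close>.\<close>
  define X where "X = x * a + y * b + z * (d + f * k / ?s)"
  define Y where "Y = y * c + z * (e + f * t * k / ?s)"
  define Z where "Z = z * (f / ?s)"
  have rat: "X \<in> \<rat>" "Y \<in> \<rat>" "Z \<in> \<rat>"
    by (auto simp: X_def Y_def Z_def)
  have EB: "(E ** B) *v v = E *v (vector [X, Y, Z])"
    unfolding matrix_vector_mul_assoc[symmetric]
    by (rule arg_cong[of _ _ "(*v) E"])
      (simp add: vec_eq_iff forall_3 matrix_vector_mult_def sum_3 B_def X_def Y_def Z_def xyz algebra_simps)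
  define \<beta> where "\<beta> = X + Y * al + Z * be"
  have "\<beta> = real_of_int x * a + y * (b + c * al) + z * (d + e * al + f * theta h k)"
    unfolding \<beta>_def X_def Y_def Z_def theta by (simp add: algebra_simps)
  then have "\<beta> \<in> I"
    unfolding I_eq by blast
  moreover have "\<bar>\<beta>\<bar> < L" "cmod (shadow K \<beta>) < L\<^sup>2"
    using v(1) unfolding EB C_def \<beta>_def cmod_shadow[OF rat]
    by (simp_all add: matrix_vector_mult_def sum_3 E_def algebra_simps add_divide_distrib)
  ultimately have "\<beta> = 0"
    using red unfolding reduced_ideal_def L_def by blast
  \<comment> \<open>Back substitution through the triangular \<open>B\<close> now gives
    \<open>v = 0\<close>, against the choice of \<open>v\<close>.\<close>
  then have XYZ: "X = 0" "Y = 0" "Z = 0"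
    using lin_indep[OF rat] unfolding \<beta>_def by auto
  then have "z = 0"
    using pos sigma_pos by (simp add: Z_def)
  then have "y = 0"
    using XYZ pos by (simp add: Y_def)
  then have "x = 0"
    using XYZ pos \<open>z = 0\<close> by (simp add: X_def)
  then have "v = 0"
    using xyz \<open>y = 0\<close> \<open>z = 0\<close> by (simp add: vec_eq_iff forall_3)
  then show False
    using v(2) by simp
qed

end

theorem mainTheorem5:
  fixes h k :: nat and I :: "real set"
  assumes "0 < k" and "k < h" and "coprime h k" and "squarefree h" and "squarefree k"
    and "primitive_ideal h k I"
    and "real (ideal_length I) > 6 * sqrt 3 * real (radicand h k) / pi"
  shows "\<not> reduced_ideal h k I"
proof -
  interpret pure_cubic h k
    using assms by unfold_locales
  show ?thesis
    using assms by (intro not_reduced)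
qed

end
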